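(* (Chaplygin sleigh.) Let $m>0$, $I>0$, $a\in\mathbb{R}$ with $I>ma^2$, and let $U(\mathbf q)$, $\mathbf q=(q_1,q_2)$, be smooth, where $q_1$ is an angle and $q_2\in\mathbb{R}$. Consider the system with Lagrangian $$L=\frac12m(\dot q_2^2+\dot q_3^2)+\frac12I\dot q_1^2+ma\,\dot q_1(-\dot q_2\sin q_1+\dot q_3\cos q_1)-U(\mathbf q)$$ and nonholonomic constraint $\dot q_3-\frac{\cos q_1}{\sin q_1}\dot q_2=0$, and its reduced system in the variables $(\mathbf q,\mathbf P)$ (see context), on the domain $\sin q_1\neq0$. Then: (1) The relation $\frac{\partial^2S}{\partial q_1\partial P_1}+\frac{\partial^2S}{\partial q_2\partial P_2}=0$ holds (identically) only for $a=0$; in particular, for $a\neq0$ there is no invariant measure $\mathcal N(\mathbf q)\,d\mathbf q\,d\mathbf P$ with smooth positive density depending on $\mathbf q$ only. (2) For $a=0$ the function $\mathcal N=\sin q_1$ satisfies $\operatorname{div}(\mathcal N\mathbf v)=0$, where $\mathbf v$ is the vector field of the reduced system, and in the variables $(\mathbf q,\mathbf p)$, $\mathbf p=\mathcal N\mathbf P$, the equations of motion take the conformally Hamiltonian form $\dot q_i=\mathcal N\frac{\partial\overline H}{\partial p_i}$, $\dot p_i=-\mathcal N\frac{\partial\overline H}{\partial q_i}$, $i=1,2$, with $$\overline H=\frac{p_1^2}{2I\sin^2q_1}+\frac{p_2^2}{2m}+U(\mathbf q).$$ (3) For $a=0$, on each of the two components $q_1\in(0,\pi)$ and $q_1\in(\pi,2\pi)$,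 the change of variables $$x=\sqrt{\frac Im}\cos q_1,\quad p_x=-\sqrt{\frac mI}\frac{p_1}{\sin q_1},\quad y=q_2,\quad p_y=p_2$$ is canonical and transforms $\overline H$ into the Hamiltonian of a mass point on a plane in a potential field, $$H^{(p)}=\frac{p_x^2+p_y^2}{2m}+V(x,y),\qquad V(x,y)=U(q_1(x),y).$$
   Context: For the constraint $\dot q_3=a_1(\mathbf q)\dot q_1+a_2(\mathbf q)\dot q_2$ (here $a_1=0$, $a_2=\cos q_1/\sin q_1$) let $L^*$ be $L$ with $\dot q_3$ eliminated by the constraint, $S=\left(\frac{\partial L}{\partial\dot q_3}\right)^{*}\left(\frac{\partial a_1}{\partial q_2}-\frac{\partial a_2}{\partial q_1}\right)$ (with $(\cdot)^*$ meaning that $\dot q_3$ is eliminated by the constraint after differentiation), $P_i=\partial L^*/\partial\dot q_i$ ($i=1,2$), $H=P_1\dot q_1+P_2\dot q_2-L^*$; $H$ and $S$ are expressed as functions of $(\mathbf q,\mathbf P)$. The reduced system is $$\dot q_i=\frac{\partial H}{\partial P_i},\quad \dot P_1=-\frac{\partial H}{\partial q_1}+\frac{\partial H}{\partial P_2}S,\quad \dot P_2=-\frac{\partial H}{\partial q_2}-\frac{\partial H}{\partial P_1}S .$$ A measure $\mathcal N\,d\mathbf q\,d\mathbf P$ is invariant if $\operatorname{div}(\mathcal N\mathbf v)=0$ for the vector field $\mathbf v$ of this system. Here $m$ is the mass of the body and $I$ its moment of inertia about the origin of the body frame, $a$ is a parameter giving the position of the center of mass, and $q_1(x)$ is the inverse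 of $x(q_1)$ on the component considered. *)

theory Defs
  imports "HOL-Analysis.Analysis"
begin

section \<open>Smooth maps and partial derivatives\<close>

text \<open>Meant for open \<open>S\<close>; in finite dimension \<open>Ck_on k S f\<close> is then the usual class $C^k$.\<close>

primrec Ck_on :: "nat \<Rightarrow> 'a::real_normed_vector set \<Rightarrow> ('a \<Rightarrow> 'b::real_normed_vector) \<Rightarrow> bool" where
  "Ck_on 0 S f = continuous_on S f"
| "Ck_on (Suc k) S f =
    ((\<forall>x\<in>S. f differentiable (at x)) \<and>
     (\<forall>v. Ck_on k S (\<lambda>x. frechet_derivative f (at x) v)))"

definition smooth_on :: "'a::real_normed_vector set \<Rightarrow> ('a \<Rightarrow> 'b::real_normed_vector) \<Rightarrow> bool" where
  "smooth_on S f \<longleftrightarrow> (\<forall>k. Ck_on k S f)"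

type_synonym pair = "real \<times> real"
type_synonym phase = "pair \<times> pair"

definition pd1 :: "(pair \<Rightarrow> real) \<Rightarrow> pair \<Rightarrow> real" where
  "pd1 f z = deriv (\<lambda>s. f (s, snd z)) (fst z)"

definition pd2 :: "(pair \<Rightarrow> real) \<Rightarrow> pair \<Rightarrow> real" where
  "pd2 f z = deriv (\<lambda>s. f (fst z, s)) (snd z)"

definition phase_div :: "(phase \<Rightarrow> phase) \<Rightarrow> phase \<Rightarrow> real" where
  "phase_div X = (\<lambda>(q, P).
     pd1 (\<lambda>q'. fst (fst (X (q', P)))) q + pd2 (\<lambda>q'. snd (fst (X (q', P)))) q +
     pd1 (\<lambda>P'. fst (snd (X (q, P')))) P + pd2 (\<lambda>P'. snd (snd (X (q, P')))) P)"

definition solves_on :: "(phase \<Rightarrow> phase) \<Rightarrow> real set \<Rightarrow> (real \<Rightarrow> phase) \<Rightarrow> bool" where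
  "solves_on X T \<gamma> \<longleftrightarrow> (\<forall>t\<in>T. (\<gamma> has_vector_derivative X (\<gamma> t)) (at t))"

section \<open>Reduction of a Chaplygin system\<close>

text \<open>
  The Lagrangian \<open>L q (v\<^sub>1, v\<^sub>2, v\<^sub>3)\<close> and the coefficients of the constraint
  \<open>v\<^sub>3 = a\<^sub>1 q * v\<^sub>1 + a\<^sub>2 q * v\<^sub>2\<close> depend on \<open>q = (q\<^sub>1, q\<^sub>2)\<close> only.
\<close>

type_synonym lagrangian = "pair \<Rightarrow> real \<times> real \<times> real \<Rightarrow> real"

definition constr_v3 :: "(pair \<Rightarrow> real) \<Rightarrow> (pair \<Rightarrow> real) \<Rightarrow> pair \<Rightarrow> pair \<Rightarrow> real" where
  "constr_v3 a1 a2 q v = a1 q * fst v + a2 q * snd v"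

definition Lstar :: "lagrangian \<Rightarrow> (pair \<Rightarrow> real) \<Rightarrow> (pair \<Rightarrow> real) \<Rightarrow> pair \<Rightarrow> pair \<Rightarrow> real" where
  "Lstar L a1 a2 q v = L q (fst v, snd v, constr_v3 a1 a2 q v)"

definition S_vel :: "lagrangian \<Rightarrow> (pair \<Rightarrow> real) \<Rightarrow> (pair \<Rightarrow> real) \<Rightarrow> pair \<Rightarrow> pair \<Rightarrow> real" where
  "S_vel L a1 a2 q v =
     deriv (\<lambda>s. L q (fst v, snd v, s)) (constr_v3 a1 a2 q v) * (pd2 a1 q - pd1 a2 q)"

definition momentum :: "lagrangian \<Rightarrow> (pair \<Rightarrow> real) \<Rightarrow> (pair \<Rightarrow> real) \<Rightarrow> pair \<Rightarrow> pair \<Rightarrow> pair" where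
  "momentum L a1 a2 q v = (pd1 (Lstar L a1 a2 q) v, pd2 (Lstar L a1 a2 q) v)"

text \<open>Meaningful only where \<open>momentum L a1 a2 q\<close> is a bijection.\<close>

definition velocity :: "lagrangian \<Rightarrow> (pair \<Rightarrow> real) \<Rightarrow> (pair \<Rightarrow> real) \<Rightarrow> pair \<Rightarrow> pair \<Rightarrow> pair" where
  "velocity L a1 a2 q P = (THE v. momentum L a1 a2 q v = P)"

definition Ham :: "lagrangian \<Rightarrow> (pair \<Rightarrow> real) \<Rightarrow> (pair \<Rightarrow> real) \<Rightarrow> pair \<Rightarrow> pair \<Rightarrow> real" where
  "Ham L a1 a2 q P =
     (let v = velocity L a1 a2 q P in fst P * fst v + snd P * snd v - Lstar L a1 a2 q v)"

definition S_fun :: "lagrangian \<Rightarrow> (pair \<Rightarrow> real) \<Rightarrow> (pair \<Rightarrow> real) \<Rightarrow> pair \<Rightarrow> pair \<Rightarrow> real" where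
  "S_fun L a1 a2 q P = S_vel L a1 a2 q (velocity L a1 a2 q P)"

definition reduced_field :: "lagrangian \<Rightarrow> (pair \<Rightarrow> real) \<Rightarrow> (pair \<Rightarrow> real) \<Rightarrow> phase \<Rightarrow> phase" where
  "reduced_field L a1 a2 = (\<lambda>(q, P).
     let H = Ham L a1 a2; S = S_fun L a1 a2 q P in
     ((pd1 (H q) P, pd2 (H q) P),
      (- pd1 (\<lambda>q'. H q' P) q + pd2 (H q) P * S,
       - pd2 (\<lambda>q'. H q' P) q - pd1 (H q) P * S)))"

definition invariant_density_on :: "pair set \<Rightarrow> (phase \<Rightarrow> phase) \<Rightarrow> (pair \<Rightarrow> real) \<Rightarrow> bool" where
  "invariant_density_on Q X N \<longleftrightarrow>
     (\<forall>q\<in>Q. \<forall>P. phase_div (\<lambda>z. N (fst z) *\<^sub>R X z) (q, P) = 0)"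

definition conf_ham_field :: "(pair \<Rightarrow> real) \<Rightarrow> (phase \<Rightarrow> real) \<Rightarrow> phase \<Rightarrow> phase" where
  "conf_ham_field N K = (\<lambda>(q, p).
     ((N q * pd1 (\<lambda>p'. K (q, p')) p, N q * pd2 (\<lambda>p'. K (q, p')) p),
      (- (N q * pd1 (\<lambda>q'. K (q', p)) q), - (N q * pd2 (\<lambda>q'. K (q', p)) q))))"

section \<open>Canonical changes of variables\<close>

definition smooth_diffeo_on :: "'a::real_normed_vector set \<Rightarrow> ('a \<Rightarrow> 'b::real_normed_vector) \<Rightarrow> bool" where
  "smooth_diffeo_on D \<Phi> \<longleftrightarrow>
     open D \<and> smooth_on D \<Phi> \<and> inj_on \<Phi> D \<and> open (\<Phi> ` D) \<and>
     smooth_on (\<Phi> ` D) (the_inv_into D \<Phi>)"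

text \<open>The form $dp_1 \wedge dq_1 + dp_2 \wedge dq_2$.\<close>

definition symp :: "phase \<Rightarrow> phase \<Rightarrow> real" where
  "symp u w = snd u \<bullet> fst w - fst u \<bullet> snd w"

definition canonical_on :: "phase set \<Rightarrow> (phase \<Rightarrow> phase) \<Rightarrow> bool" where
  "canonical_on D \<Phi> \<longleftrightarrow>
     smooth_diffeo_on D \<Phi> \<and>
     (\<forall>z\<in>D. \<forall>u w. symp (frechet_derivative \<Phi> (at z) u) (frechet_derivative \<Phi> (at z) w) = symp u w)"

section \<open>The Chaplygin sleigh\<close>

definition sleigh_L :: "real \<Rightarrow> real \<Rightarrow> real \<Rightarrow> (pair \<Rightarrow> real) \<Rightarrow> lagrangian" where
  "sleigh_L m I a U = (\<lambda>q (v1, v2, v3).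
     1/2 * m * (v2\<^sup>2 + v3\<^sup>2) + 1/2 * I * v1\<^sup>2
     + m * a * v1 * (- v2 * sin (fst q) + v3 * cos (fst q)) - U q)"

definition sleigh_a1 :: "pair \<Rightarrow> real" where
  "sleigh_a1 q = 0"

definition sleigh_a2 :: "pair \<Rightarrow> real" where
  "sleigh_a2 q = cos (fst q) / sin (fst q)"

abbreviation sleigh_H :: "real \<Rightarrow> real \<Rightarrow> real \<Rightarrow> (pair \<Rightarrow> real) \<Rightarrow> pair \<Rightarrow> pair \<Rightarrow> real" where
  "sleigh_H m I a U \<equiv> Ham (sleigh_L m I a U) sleigh_a1 sleigh_a2"

abbreviation sleigh_S :: "real \<Rightarrow> real \<Rightarrow> real \<Rightarrow> (pair \<Rightarrow> real) \<Rightarrow> pair \<Rightarrow> pair \<Rightarrow> real" where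
  "sleigh_S m I a U \<equiv> S_fun (sleigh_L m I a U) sleigh_a1 sleigh_a2"

abbreviation sleigh_field :: "real \<Rightarrow> real \<Rightarrow> real \<Rightarrow> (pair \<Rightarrow> real) \<Rightarrow> phase \<Rightarrow> phase" where
  "sleigh_field m I a U \<equiv> reduced_field (sleigh_L m I a U) sleigh_a1 sleigh_a2"

definition sleigh_N :: "pair \<Rightarrow> real" where
  "sleigh_N q = sin (fst q)"

definition sleigh_Hbar :: "real \<Rightarrow> real \<Rightarrow> (pair \<Rightarrow> real) \<Rightarrow> phase \<Rightarrow> real" where
  "sleigh_Hbar m I U = (\<lambda>(q, p).
     (fst p)\<^sup>2 / (2 * I * (sin (fst q))\<^sup>2) + (snd p)\<^sup>2 / (2 * m) + U q)"

definition sleigh_x :: "real \<Rightarrow> real \<Rightarrow> real \<Rightarrow> real" where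
  "sleigh_x m I q1 = sqrt (I / m) * cos q1"

definition sleigh_change :: "real \<Rightarrow> real \<Rightarrow> phase \<Rightarrow> phase" where
  "sleigh_change m I = (\<lambda>((q1, q2), (p1, p2)).
     ((sleigh_x m I q1, q2), (- sqrt (m / I) * (p1 / sin q1), p2)))"

text \<open>\<open>C\<close> is the component of the \<open>q\<^sub>1\<close>-domain on which $x(q_1)$ is inverted.\<close>

definition point_V :: "real \<Rightarrow> real \<Rightarrow> (pair \<Rightarrow> real) \<Rightarrow> real set \<Rightarrow> real \<Rightarrow> real \<Rightarrow> real" where
  "point_V m I U C x y = U (the_inv_into C (sleigh_x m I) x, y)"

definition point_H :: "real \<Rightarrow> (real \<Rightarrow> real \<Rightarrow> real) \<Rightarrow> phase \<Rightarrow> real" where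
  "point_H m V = (\<lambda>((x, y), (px, py)). (px\<^sup>2 + py\<^sup>2) / (2 * m) + V x y)"

end

(* With disc = I - m a^2 cos(2 q1)^2 one finds H = (A P1^2 + 2 B P1 P2 + E P2^2) / 2 + U and
   S = F P1 + G P2, all five coefficients depending on q1 only.  For a density N(q) this gives
   div (N v) = (dN/dq1 - N G) dq1/dt + (dN/dq2 + N F) dq2/dt, so that N is invariant iff
   d(ln N)/dq1 = G and d(ln N)/dq2 = -F.  These equations are compatible only if dF/dq1 = 0,
   whereas F = 2 m a cos q1 / disc; for a = 0 they have the solution N = sin q1.  The change of
   variables in (3) is the cotangent lift of q1 |-> x(q1). *)

theory Submission
  imports Defs
begin

section \<open>Smooth maps\<close>

text \<open>The relation in (1) is the compatibility condition for the two equations for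
  \<open>ln N\<close>: as S is linear in P, it reads dF/dq1 + dG/dq2 = 0, and G does not depend on
  q2. Both claims of (1) thus rest on F being non-constant on every component. The evidence sits at
  the zero of the cosine that each component contains: there F vanishes, while its derivative is -2
  m a sin q1 / disc. The nonexistence proof never differentiates N twice; it compares the growth of
  \<open>ln N\<close> in q2 at two values of q1.

  The closed formulas for H and S hold only where sin q1 \<noteq> 0, so they enter derivatives in q1
  through the openness of that set. In (3) the laborious point is smoothness: a canonical map has to
  be a smooth diffeomorphism, and smoothness is an infinite tower of Frechet derivatives. For the
  map and for its explicit inverse, a finite set of functions is exhibited whose algebra is closed
  under differentiation.\<close>

lemma Ck_on_cong:
  assumes "open S" "\<And>x. x \<in> S \<Longrightarrow> f x = g x"
  shows "Ck_on k S f = Ck_on k S g"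
  using assms(2)
proof (induction k arbitrary: f g)
  case 0
  then show ?case by (simp cong: continuous_on_cong)
next
  case (Suc k)
  have d: "(f has_derivative D) (at x) \<longleftrightarrow> (g has_derivative D) (at x)" if "x \<in> S" for x D
    using has_derivative_transform_within_open[OF _ \<open>open S\<close> that] Suc.prems by metis
  \<comment> \<open>\<open>frechet_derivative\<close> is a choice among all derivatives at the
    point; at points of S both functions have the same ones, so the choices coincide.\<close>
  have "Ck_on k S (\<lambda>x. frechet_derivative f (at x) v) = Ck_on k S (\<lambda>x. frechet_derivative g (at x) v)" for v
    by (rule Suc.IH) (simp add: frechet_derivative_def d)
  then show ?case
    by (simp add: differentiable_def d)
qed

text \<open>Smoothness is established for real-valued functions; this assembles maps into the phase
  space from their coordinates.\<close>

lemma Ck_on_Pair: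
  assumes "open S" "Ck_on k S f" "Ck_on k S g"
  shows "Ck_on k S (\<lambda>x. (f x, g x))"
  using assms(2,3)
proof (induction k arbitrary: f g)
  case 0
  then show ?case by (auto intro: continuous_on_Pair)
next
  case (Suc k)
  have d: "((\<lambda>x. (f x, g x)) has_derivative
      (\<lambda>v. (frechet_derivative f (at x) v, frechet_derivative g (at x) v))) (at x)" if "x \<in> S" for x
    using Suc.prems that by (intro has_derivative_Pair) (auto simp: frechet_derivative_works)
  have "Ck_on k S (\<lambda>x. frechet_derivative (\<lambda>x. (f x, g x)) (at x) v)" for v
    using Suc.IH[of "\<lambda>x. frechet_derivative f (at x) v" "\<lambda>x. frechet_derivative g (at x) v"] Suc.prems
    by (subst Ck_on_cong[OF \<open>open S\<close>, where g = "\<lambda>x. (frechet_derivative f (at x) v, frechet_derivative g (at x) v)"])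
      (auto simp flip: frechet_derivative_at[OF d])
  then show ?case
    using d by (auto simp: differentiable_def)
qed

lemma smooth_on_cong:
  "open S \<Longrightarrow> (\<And>x. x \<in> S \<Longrightarrow> f x = g x) \<Longrightarrow> smooth_on S f = smooth_on S g"
  unfolding smooth_on_def using Ck_on_cong by metis

lemma smooth_on_Pair:
  "open S \<Longrightarrow> smooth_on S f \<Longrightarrow> smooth_on S g \<Longrightarrow> smooth_on S (\<lambda>x. (f x, g x))"
  by (simp add: smooth_on_def Ck_on_Pair)

text \<open>If every generator has directional derivatives in the algebra again, then so does every element,
  hence all of them are smooth; no chain rule for \<open>Ck_on\<close> is needed.\<close>

inductive_set fun_algebra :: "('a \<Rightarrow> real) set \<Rightarrow> ('a \<Rightarrow> real) set" for G where
  const: "(\<lambda>x. c) \<in> fun_algebra G"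
| gen: "g \<in> G \<Longrightarrow> g \<in> fun_algebra G"
| add: "f \<in> fun_algebra G \<Longrightarrow> g \<in> fun_algebra G \<Longrightarrow> (\<lambda>x. f x + g x) \<in> fun_algebra G"
| mult: "f \<in> fun_algebra G \<Longrightarrow> g \<in> fun_algebra G \<Longrightarrow> (\<lambda>x. f x * g x) \<in> fun_algebra G"

lemma smooth_on_fun_algebra:
  fixes G :: "('a::real_normed_vector \<Rightarrow> real) set"
  assumes S: "open S"
    and G: "\<And>g. g \<in> G \<Longrightarrow> \<exists>D. (\<forall>x\<in>S. (g has_derivative D x) (at x)) \<and> (\<forall>v. (\<lambda>x. D x v) \<in> fun_algebra G)"
    and f: "f \<in> fun_algebra G"
  shows "smooth_on S f"
proof -
  have D: "\<exists>D. (\<forall>x\<in>S. (f has_derivative D x) (at x)) \<and> (\<forall>v. (\<lambda>x. D x v) \<in> fun_algebra G)"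
    if "f \<in> fun_algebra G" for f
    using that
  proof induction
    case (const c)
    show ?case by (rule exI[of _ "\<lambda>_ _. 0"]) (auto intro: fun_algebra.const)
  next
    case (gen g)
    then show ?case by (rule G)
  next
    case (add f g)
    then obtain D E where "\<forall>x\<in>S. (f has_derivative D x) (at x)" "\<forall>v. (\<lambda>x. D x v) \<in> fun_algebra G"
      "\<forall>x\<in>S. (g has_derivative E x) (at x)" "\<forall>v. (\<lambda>x. E x v) \<in> fun_algebra G"
      by blast
    then show ?case
      by (intro exI[of _ "\<lambda>x v. D x v + E x v"]) (auto intro: fun_algebra.add derivative_intros)
  next
    case (mult f g)
    then obtain D E where "\<forall>x\<in>S. (f has_derivative D x) (at x)" "\<forall>v. (\<lambda>x. D x v) \<in> fun_algebra G"
      "\<forall>x\<in>S. (g has_derivative E x) (at x)" "\<forall>v. (\<lambda>x. E x v) \<in> fun_algebra G"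
      by blast
    with mult.hyps show ?case
      by (intro exI[of _ "\<lambda>x v. f x * E x v + D x v * g x"] conjI ballI allI has_derivative_mult
          fun_algebra.add fun_algebra.mult) auto
  qed
  have "Ck_on k S f" if "f \<in> fun_algebra G" for k f
    using that
  proof (induction k arbitrary: f)
    case 0
    then show ?case
      using D[OF 0] by (metis Ck_on.simps(1) continuous_at_imp_continuous_on has_derivative_continuous)
  next
    case (Suc k)
    from D[OF Suc.prems] obtain D where D: "\<And>x. x \<in> S \<Longrightarrow> (f has_derivative D x) (at x)"
      "\<And>v. (\<lambda>x. D x v) \<in> fun_algebra G" by blast
    have "Ck_on k S (\<lambda>x. frechet_derivative f (at x) v)" for v
      using Suc.IH[OF D(2)[of v]]
      by (subst Ck_on_cong[OF S, where g = "\<lambda>x. D x v"]) (auto simp flip: frechet_derivative_at[OF D(1)])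
    then show ?case
      using D(1) by (auto simp: differentiable_def)
  qed
  then show ?thesis
    using f by (simp add: smooth_on_def)
qed

lemma fun_algebra_scale:
  "f \<in> fun_algebra G \<Longrightarrow> (\<lambda>x. f x * c) \<in> fun_algebra G"
  "f \<in> fun_algebra G \<Longrightarrow> (\<lambda>x. c * f x) \<in> fun_algebra G"
  "f \<in> fun_algebra G \<Longrightarrow> (\<lambda>x. - f x) \<in> fun_algebra G"
  using fun_algebra.mult[OF _ fun_algebra.const] fun_algebra.mult[OF fun_algebra.const]
    fun_algebra.mult[OF fun_algebra.const[of "- 1"]] by auto

section \<open>The change of variables\<close>

lemma sleigh_change_has_derivative:
  assumes "sin (fst (fst z)) \<noteq> 0"
  shows "(sleigh_change m I has_derivative
    (\<lambda>u. ((- sqrt (I / m) * sin (fst (fst z)) * fst (fst u), snd (fst u)),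
     (- sqrt (m / I) * (fst (snd u) / sin (fst (fst z)) - fst (snd z) * cos (fst (fst z)) / (sin (fst (fst z)))\<^sup>2 * fst (fst u)),
      snd (snd u))))) (at z)"
proof -
  have eq: "sleigh_change m I = (\<lambda>z. ((sqrt (I / m) * cos (fst (fst z)), snd (fst z)),
     (- sqrt (m / I) * (fst (snd z) / sin (fst (fst z))), snd (snd z))))"
    by (auto simp: sleigh_change_def sleigh_x_def fun_eq_iff)
  show ?thesis
    unfolding eq using assms
    by (auto intro!: derivative_eq_intros ext simp: field_simps power2_eq_square)
qed

lemma smooth_sleigh_change:
  assumes "open D" "\<And>z. z \<in> D \<Longrightarrow> sin (fst (fst z)) \<noteq> 0"
  shows "smooth_on D (sleigh_change m I)"
proof -
  \<comment> \<open>The components of the map are polynomials in these functions. Sine and cosine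
    differentiate into each other, and 1/sin into -cos times its own square, so no further generator
    arises.\<close>
  define G :: "(phase \<Rightarrow> real) set" where
    "G = {\<lambda>z. fst (snd z), \<lambda>z. snd (fst z), \<lambda>z. snd (snd z),
      \<lambda>z. cos (fst (fst z)), \<lambda>z. sin (fst (fst z)), \<lambda>z. inverse (sin (fst (fst z)))}"
  have eq: "sleigh_change m I = (\<lambda>z. ((sqrt (I / m) * cos (fst (fst z)), snd (fst z)),
     (- sqrt (m / I) * (fst (snd z) * inverse (sin (fst (fst z)))), snd (snd z))))"
    by (auto simp: sleigh_change_def sleigh_x_def fun_eq_iff divide_inverse)
  have gs: "(\<lambda>z. fst (snd z)) \<in> fun_algebra G" "(\<lambda>z. snd (fst z)) \<in> fun_algebra G" "(\<lambda>z. snd (snd z)) \<in> fun_algebra G"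
    "(\<lambda>z. cos (fst (fst z))) \<in> fun_algebra G" "(\<lambda>z. sin (fst (fst z))) \<in> fun_algebra G"
    "(\<lambda>z. inverse (sin (fst (fst z)))) \<in> fun_algebra G"
    by (auto intro!: fun_algebra.gen simp: G_def)
  note intros = fun_algebra_scale fun_algebra.const fun_algebra.mult fun_algebra.add gs
  have "\<exists>E. (\<forall>x\<in>D. (g has_derivative E x) (at x)) \<and> (\<forall>v. (\<lambda>x. E x v) \<in> fun_algebra G)" if "g \<in> G" for g
  proof -
    show ?thesis
      using that[unfolded G_def insert_iff empty_iff]
    proof (elim disjE FalseE)
      assume 1: "g = (\<lambda>z. fst (snd z))"
      show ?thesis unfolding 1
        by (rule exI[of _ "\<lambda>z v. fst (snd v)"]) (auto intro!: derivative_eq_intros intro: intros)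
    next
      assume 2: "g = (\<lambda>z. snd (fst z))"
      show ?thesis unfolding 2
        by (rule exI[of _ "\<lambda>z v. snd (fst v)"]) (auto intro!: derivative_eq_intros intro: intros)
    next
      assume 3: "g = (\<lambda>z. snd (snd z))"
      show ?thesis unfolding 3
        by (rule exI[of _ "\<lambda>z v. snd (snd v)"]) (auto intro!: derivative_eq_intros intro: intros)
    next
      assume 4: "g = (\<lambda>z. cos (fst (fst z)))"
      show ?thesis unfolding 4
        by (rule exI[of _ "\<lambda>z v. - sin (fst (fst z)) * fst (fst v)"])
          (auto intro!: derivative_eq_intros intros)
    next
      assume 5: "g = (\<lambda>z. sin (fst (fst z)))"
      show ?thesis unfolding 5
        by (rule exI[of _ "\<lambda>z v. cos (fst (fst z)) * fst (fst v)"])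
          (auto intro!: derivative_eq_intros intros)
    next
      assume 6: "g = (\<lambda>z. inverse (sin (fst (fst z))))"
      have "((\<lambda>z. inverse (sin (fst (fst z)))) has_derivative
        (\<lambda>v. - (cos (fst (fst z)) * inverse (sin (fst (fst z))) * inverse (sin (fst (fst z)))) * fst (fst v))) (at z)"
        if "z \<in> D" for z :: phase
        using assms(2)[OF that] by (auto intro!: derivative_eq_intros simp: fun_eq_iff field_simps)
      then show ?thesis unfolding 6
        by (intro exI[of _ "\<lambda>z v. - (cos (fst (fst z)) * inverse (sin (fst (fst z))) * inverse (sin (fst (fst z)))) * fst (fst v)"]
            conjI ballI allI intros) auto
    qed
  qed
  from smooth_on_fun_algebra[OF assms(1) this]
  have sm: "f \<in> fun_algebra G \<Longrightarrow> smooth_on D f" for f .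
  show ?thesis
    unfolding eq by (intro smooth_on_Pair assms(1) sm intros)
qed

text \<open>Here \<open>sqrt (m / I) * x\<close> is cos q1, and \<open>\<kappa>\<close> times the
  square root of 1 - (cos q1)^2 is sin q1, \<open>\<kappa>\<close> being the sign of the sine on the
  component. The first coordinate is arccos for \<open>\<kappa> = 1\<close> and 2 pi - arccos for
  \<open>\<kappa> = -1\<close>.\<close>

definition sleigh_change_inv :: "real \<Rightarrow> real \<Rightarrow> real \<Rightarrow> phase \<Rightarrow> phase" where
  "sleigh_change_inv m I \<kappa> = (\<lambda>((x, y), (px, py)).
     (((1 - \<kappa>) * pi + \<kappa> * arccos (sqrt (m / I) * x), y),
      (- sqrt (I / m) * (px * (\<kappa> * sqrt (1 - (sqrt (m / I) * x)\<^sup>2))), py)))"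

lemma smooth_sleigh_change_inv:
  assumes "open D" and D: "\<And>z. z \<in> D \<Longrightarrow> \<bar>sqrt (m / I) * fst (fst z)\<bar> < 1"
  shows "smooth_on D (sleigh_change_inv m I \<kappa>)"
proof -
  define d where "d = sqrt (m / I)"
  define w :: "phase \<Rightarrow> real" where "w = (\<lambda>z. sqrt (1 - (d * fst (fst z))\<^sup>2))"
  \<comment> \<open>The derivative of \<open>w\<close> is a multiple of x / w and that of the arccos
    a multiple of 1 / w, so adding the reciprocal of \<open>w\<close> closes the algebra. The strict
    bound on D keeps \<open>w\<close> positive.\<close>
  define G :: "(phase \<Rightarrow> real) set" where
    "G = {\<lambda>z. fst (snd z), \<lambda>z. snd (fst z), \<lambda>z. snd (snd z), \<lambda>z. fst (fst z),
      w, \<lambda>z. inverse (w z), \<lambda>z. arccos (d * fst (fst z))}"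
  have eq: "sleigh_change_inv m I \<kappa> = (\<lambda>z. (((1 - \<kappa>) * pi + \<kappa> * arccos (d * fst (fst z)), snd (fst z)),
      (- sqrt (I / m) * (fst (snd z) * (\<kappa> * w z)), snd (snd z))))"
    by (auto simp: sleigh_change_inv_def w_def d_def fun_eq_iff)
  have gs: "(\<lambda>z. fst (snd z)) \<in> fun_algebra G" "(\<lambda>z. snd (fst z)) \<in> fun_algebra G" "(\<lambda>z. snd (snd z)) \<in> fun_algebra G"
    "(\<lambda>z. fst (fst z)) \<in> fun_algebra G" "(\<lambda>z. w z) \<in> fun_algebra G" "(\<lambda>z. inverse (w z)) \<in> fun_algebra G"
    "(\<lambda>z. arccos (d * fst (fst z))) \<in> fun_algebra G"
    by (auto intro!: fun_algebra.gen simp: G_def)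
  note intros = fun_algebra_scale fun_algebra.const fun_algebra.mult fun_algebra.add gs
  have sq: "(d * fst (fst z))\<^sup>2 < 1" if "z \<in> D" for z
    using D[OF that] by (simp add: d_def abs_square_less_1)
  then have w_pos: "w z > 0" if "z \<in> D" for z
    using that by (simp add: w_def)
  have dw: "(w has_derivative (\<lambda>v. - d\<^sup>2 * (fst (fst z) * inverse (w z)) * fst (fst v))) (at z)" if "z \<in> D" for z
    unfolding w_def using sq[OF that]
    by (auto intro!: derivative_eq_intros simp: fun_eq_iff field_simps power2_eq_square)
  have "\<exists>E. (\<forall>x\<in>D. (g has_derivative E x) (at x)) \<and> (\<forall>v. (\<lambda>x. E x v) \<in> fun_algebra G)" if "g \<in> G" for g
    using that[unfolded G_def insert_iff empty_iff]
  proof (elim disjE FalseE)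
    assume 1: "g = (\<lambda>z. fst (snd z))"
    show ?thesis unfolding 1
      by (rule exI[of _ "\<lambda>z v. fst (snd v)"]) (auto intro!: derivative_eq_intros intro: intros)
  next
    assume 1: "g = (\<lambda>z. snd (fst z))"
    show ?thesis unfolding 1
      by (rule exI[of _ "\<lambda>z v. snd (fst v)"]) (auto intro!: derivative_eq_intros intro: intros)
  next
    assume 1: "g = (\<lambda>z. snd (snd z))"
    show ?thesis unfolding 1
      by (rule exI[of _ "\<lambda>z v. snd (snd v)"]) (auto intro!: derivative_eq_intros intro: intros)
  next
    assume 1: "g = (\<lambda>z. fst (fst z))"
    show ?thesis unfolding 1
      by (rule exI[of _ "\<lambda>z v. fst (fst v)"]) (auto intro!: derivative_eq_intros intro: intros)
  next
    assume 1: "g = w"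
    show ?thesis unfolding 1
      by (intro exI[of _ "\<lambda>z v. - d\<^sup>2 * (fst (fst z) * inverse (w z)) * fst (fst v)"]
          conjI ballI allI dw intros)
  next
    assume 1: "g = (\<lambda>z. inverse (w z))"
    have "((\<lambda>z. inverse (w z)) has_derivative
        (\<lambda>v. d\<^sup>2 * (fst (fst z) * inverse (w z) * inverse (w z) * inverse (w z)) * fst (fst v))) (at z)" if "z \<in> D" for z
      using w_pos[OF that] by (auto intro!: derivative_eq_intros dw that)
    then show ?thesis unfolding 1
      by (intro exI[of _ "\<lambda>z v. d\<^sup>2 * (fst (fst z) * inverse (w z) * inverse (w z) * inverse (w z)) * fst (fst v)"] conjI ballI allI)
        (auto intro!: intros)
  next
    assume 1: "g = (\<lambda>z. arccos (d * fst (fst z)))"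
    have "((\<lambda>z. arccos (d * fst (fst z))) has_derivative (\<lambda>v. - d * inverse (w z) * fst (fst v))) (at z)" if "z \<in> D" for z
      using D[OF that] unfolding d_def[symmetric] w_def
      by (auto intro!: derivative_eq_intros simp: fun_eq_iff field_simps)
    then show ?thesis unfolding 1
      by (intro exI[of _ "\<lambda>z v. - d * inverse (w z) * fst (fst v)"] conjI ballI allI)
        (auto intro!: intros)
  qed
  from smooth_on_fun_algebra[OF assms(1) this]
  have sm: "f \<in> fun_algebra G \<Longrightarrow> smooth_on D f" for f .
  show ?thesis
    unfolding eq by (intro smooth_on_Pair assms(1) sm intros)
qed

text \<open>The dq1-part of dp_x drops out in the wedge with dx, which is a multiple of dq1. What
  remains is the product of the factors -sqrt(m/I) / sin q1 and -sqrt(I/m) sin q1, which is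
  1.\<close>

lemma symp_sleigh_change:
  assumes mI: "m > 0" "I > 0" and s: "sin (fst (fst z)) \<noteq> 0"
  shows "symp (frechet_derivative (sleigh_change m I) (at z) u)
    (frechet_derivative (sleigh_change m I) (at z) w) = symp u w"
proof -
  have cd: "sqrt (I / m) * sqrt (m / I) = 1"
    using mI by (simp flip: real_sqrt_mult)
  obtain c d where c: "sqrt (I / m) = c" and d: "sqrt (m / I) = d" by blast
  have "c * d = 1" using cd c d by simp
  then have "c \<noteq> 0" by auto
  with \<open>c * d = 1\<close> have cd2: "c \<noteq> 0" "d = 1 / c"
    by (simp_all add: nonzero_eq_divide_eq mult.commute)
  show ?thesis
    unfolding frechet_derivative_at[OF sleigh_change_has_derivative[OF s], symmetric] symp_def c d cd2(2)
    using s cd2(1) by (simp add: inner_prod_def field_simps power2_eq_square)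
qed

text \<open>\<open>(1 - \<kappa>) * pi + \<kappa> * arccos u\<close> with \<open>\<kappa> = 1\<close>, respectively \<open>\<kappa> = -1\<close>, is the inverse of the
  cosine on the first, respectively the second component; \<open>\<kappa>\<close> is the sign of the sine there.\<close>

lemma cos_inverse_component:
  assumes "(\<kappa>, C) \<in> {(1, {0<..<pi}), (- 1, {pi<..<2 * pi})}"
  shows "\<And>x. x \<in> C \<Longrightarrow> \<kappa> * sin x > 0"
    and "\<And>x. x \<in> C \<Longrightarrow> (1 - \<kappa>) * pi + \<kappa> * arccos (cos x) = x"
    and "\<And>u. \<bar>u\<bar> < 1 \<Longrightarrow> (1 - \<kappa>) * pi + \<kappa> * arccos u \<in> C"
    and "\<And>u. \<bar>u\<bar> < 1 \<Longrightarrow> cos ((1 - \<kappa>) * pi + \<kappa> * arccos u) = u"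
proof -
  \<comment> \<open>The reflection of x at pi preserves the cosine and lands in (0, pi), where
    arccos inverts it.\<close>
  have ac: "arccos (cos x) = 2 * pi - x" if "pi < x" "x < 2 * pi" for x
    using arccos_cos[of "2 * pi - x"] that by simp
  show "\<kappa> * sin x > 0" if "x \<in> C" for x
    using assms that sin_gt_zero[of x] sin_lt_zero[of x] by auto
  show "(1 - \<kappa>) * pi + \<kappa> * arccos (cos x) = x" if "x \<in> C" for x
    using assms that ac[of x] by (auto simp: arccos_cos)
  show "(1 - \<kappa>) * pi + \<kappa> * arccos u \<in> C" if "\<bar>u\<bar> < 1" for u
    using assms that arccos_lt_bounded[of u] by auto
  show "cos ((1 - \<kappa>) * pi + \<kappa> * arccos u) = u" if "\<bar>u\<bar> < 1" for u
    using assms that by (auto simp: cos_diff cos_arccos_abs)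
qed

text \<open>Either component is mapped onto the same set \<open>R\<close>, which expresses |cos q1|
  < 1 in terms of x. The explicit map back is a two-sided inverse between \<open>D\<close> and
  \<open>R\<close>, which yields injectivity, the image and a formula for the inverse
  together.\<close>

lemma canonical_sleigh_change:
  fixes \<kappa> :: real
  assumes mI: "m > 0" "I > 0" and C: "(\<kappa>, C) \<in> {(1, {0<..<pi}), (- 1, {pi<..<2 * pi})}"
  shows "canonical_on ((C \<times> UNIV) \<times> UNIV) (sleigh_change m I)"
proof -
  note K = cos_inverse_component[OF C]
  define D :: "phase set" where "D = (C \<times> UNIV) \<times> UNIV"
  define R :: "phase set" where "R = {z. \<bar>sqrt (m / I) * fst (fst z)\<bar> < 1}"
  have cd: "sqrt (I / m) * sqrt (m / I) = 1" "sqrt (m / I) * sqrt (I / m) = 1"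
    using mI by (simp_all flip: real_sqrt_mult)
  have sabs: "sqrt (1 - (cos x)\<^sup>2) = \<kappa> * sin x" if "x \<in> C" for x
    using K(1)[OF that] C by (auto simp: sin_squared_eq[symmetric])
  have sn: "sin x \<noteq> 0" if "x \<in> C" for x
    using K(1)[OF that] by auto
  have kk: "\<kappa> * \<kappa> = 1" using C by auto
  have "open C" using C by auto
  then have oD: "open D"
    unfolding D_def by (intro open_Times) auto
  have oR: "open R"
    unfolding R_def by (intro open_Collect_less continuous_intros)
  have 1: "sleigh_change_inv m I \<kappa> (sleigh_change m I z) = z" and 2: "sleigh_change m I z \<in> R" if "z \<in> D" for z
  proof -
    obtain x y p1 p2 where z: "z = ((x, y), (p1, p2))" by (metis surj_pair)
    have x: "x \<in> C" using that by (simp add: D_def z)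
    have u: "sqrt (m / I) * (sqrt (I / m) * cos x) = cos x"
      using cd by (simp flip: mult.assoc)
    have "- sqrt (I / m) * (- sqrt (m / I) * (p1 / sin x) * (\<kappa> * (\<kappa> * sin x))) =
      (sqrt (I / m) * sqrt (m / I)) * (\<kappa> * \<kappa>) * (p1 / sin x * sin x)" by simp
    also have "\<dots> = p1" unfolding cd kk using sn[OF x] by simp
    finally show "sleigh_change_inv m I \<kappa> (sleigh_change m I z) = z"
      unfolding z sleigh_change_def sleigh_change_inv_def sleigh_x_def case_prod_conv u K(2)[OF x] sabs[OF x] by simp
    have "(cos x)\<^sup>2 < 1" using sn[OF x] by (simp add: cos_squared_eq)
    then have "\<bar>cos x\<bar> < 1" by (simp add: abs_square_less_1)
    then show "sleigh_change m I z \<in> R"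
      by (simp add: R_def z sleigh_change_def sleigh_x_def u)
  qed
  have 3: "sleigh_change m I (sleigh_change_inv m I \<kappa> w) = w" and 4: "sleigh_change_inv m I \<kappa> w \<in> D" if "w \<in> R" for w
  proof -
    obtain x y p1 p2 where w: "w = ((x, y), (p1, p2))" by (metis surj_pair)
    define u where "u = sqrt (m / I) * x"
    define Q where "Q = (1 - \<kappa>) * pi + \<kappa> * arccos u"
    have u: "\<bar>u\<bar> < 1" using that by (simp add: R_def w u_def)
    note QC = K(3)[OF u, folded Q_def] and cQ = K(4)[OF u, folded Q_def]
    show "sleigh_change_inv m I \<kappa> w \<in> D"
      using QC by (simp add: w D_def sleigh_change_inv_def Q_def u_def)
    have xu: "sqrt (I / m) * u = x"
      using cd by (simp add: u_def flip: mult.assoc)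
    have "- sqrt (m / I) * (- sqrt (I / m) * (p1 * (\<kappa> * (\<kappa> * sin Q))) / sin Q) =
      (sqrt (m / I) * sqrt (I / m)) * (\<kappa> * \<kappa>) * (p1 * sin Q / sin Q)" by simp
    also have "\<dots> = p1" unfolding cd kk using sn[OF QC] by simp
    finally show "sleigh_change m I (sleigh_change_inv m I \<kappa> w) = w"
      unfolding w sleigh_change_def sleigh_change_inv_def sleigh_x_def case_prod_conv
        u_def[symmetric] Q_def[symmetric] cQ xu using sabs[OF QC, unfolded cQ] by simp
  qed
  have im: "sleigh_change m I ` D = R"
    using 1 2 3 4 by (metis (no_types, lifting) image_eqI image_subsetI subsetI subset_antisym)
  have inj: "inj_on (sleigh_change m I) D"
    using 1 by (metis inj_on_inverseI)
  \<comment> \<open>The two inverses are compared on the image only; as \<open>R\<close> is open,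
    this suffices to transfer smoothness.\<close>
  have "the_inv_into D (sleigh_change m I) w = sleigh_change_inv m I \<kappa> w" if "w \<in> R" for w
    using the_inv_into_f_f[OF inj 4[OF that]] 3[OF that] by simp
  then have "smooth_on R (the_inv_into D (sleigh_change m I))"
    using smooth_on_cong[OF oR] smooth_sleigh_change_inv[OF oR, of m I \<kappa>] unfolding R_def by blast
  moreover have "smooth_on D (sleigh_change m I)"
    by (rule smooth_sleigh_change[OF oD]) (auto simp: D_def sn)
  ultimately show ?thesis
    unfolding canonical_on_def smooth_diffeo_on_def D_def[symmetric]
    using oD oR im inj symp_sleigh_change[OF mI] sn by (auto simp: D_def)
qed

text \<open>The factor m/I in the square of p_x turns the denominator 2m into 2I. The potentials
  agree because the cosine is injective on C, so that the inverse in \<open>point_V\<close> returns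
  the original angle.\<close>

lemma Hbar_eq_point_H:
  fixes \<kappa> :: real
  assumes mI: "m > 0" "I > 0" and C: "(\<kappa>, C) \<in> {(1, {0<..<pi}), (- 1, {pi<..<2 * pi})}"
    and z: "z \<in> (C \<times> UNIV) \<times> UNIV"
  shows "sleigh_Hbar m I U z = point_H m (point_V m I U C) (sleigh_change m I z)"
proof -
  obtain x y p1 p2 where z': "z = ((x, y), (p1, p2))" by (metis surj_pair)
  have x: "x \<in> C" using z by (simp add: z')
  have "inj_on (sleigh_x m I) C"
  proof (rule inj_onI)
    fix s t assume st: "s \<in> C" "t \<in> C" "sleigh_x m I s = sleigh_x m I t"
    then have "cos s = cos t" using mI by (simp add: sleigh_x_def)
    then show "s = t" using cos_inverse_component(2)[OF C] st(1,2) by metis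
  qed
  from the_inv_into_f_f[OF this x] show ?thesis
    using mI by (simp add: z' sleigh_Hbar_def point_H_def point_V_def sleigh_change_def
      power_mult_distrib power_divide add_divide_distrib)
qed

section \<open>The reduced system in the momenta\<close>

text \<open>Multiplied by m / (sin x)^2, this is the determinant of the symmetric matrix of the
  reduced kinetic energy.\<close>

definition disc :: "real \<Rightarrow> real \<Rightarrow> real \<Rightarrow> real \<Rightarrow> real" where
  "disc m I a x = I - m * a\<^sup>2 * (cos (2 * x))\<^sup>2"

text \<open>A, B and E are the entries of the inverse of the kinetic energy matrix; they express the
  velocities by the momenta.\<close>

definition coeff_A :: "real \<Rightarrow> real \<Rightarrow> real \<Rightarrow> real \<Rightarrow> real" where
  "coeff_A m I a x = 1 / disc m I a x"

definition coeff_B :: "real \<Rightarrow> real \<Rightarrow> real \<Rightarrow> real \<Rightarrow> real" where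
  "coeff_B m I a x = - a * sin x * cos (2 * x) / disc m I a x"

definition coeff_E :: "real \<Rightarrow> real \<Rightarrow> real \<Rightarrow> real \<Rightarrow> real" where
  "coeff_E m I a x = I * (sin x)\<^sup>2 / (m * disc m I a x)"

definition coeff_F :: "real \<Rightarrow> real \<Rightarrow> real \<Rightarrow> real \<Rightarrow> real" where
  "coeff_F m I a x = 2 * m * a * cos x / disc m I a x"

definition coeff_G :: "real \<Rightarrow> real \<Rightarrow> real \<Rightarrow> real \<Rightarrow> real" where
  "coeff_G m I a x = (I - m * a\<^sup>2 * cos (2 * x)) * cos x / (sin x * disc m I a x)"

section \<open>Partial derivatives on the domain of nonvanishing sine\<close>

lemma open_sin_nz: "open {x::real. sin x \<noteq> 0}"
  by (intro open_Collect_neq continuous_intros)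

lemma DERIV_partial1:
  assumes "(U :: pair \<Rightarrow> real) differentiable (at (x, y))"
  shows "((\<lambda>s. U (s, y)) has_real_derivative pd1 U (x, y)) (at x)"
proof -
  have "(U \<circ> (\<lambda>s. (s, y))) differentiable (at x)"
    by (rule differentiable_chain_at) (use assms in \<open>auto intro!: derivative_intros\<close>)
  then show ?thesis
    unfolding pd1_def
    by (metis (no_types, lifting) DERIV_deriv_iff_real_differentiable comp_apply ext fst_conv snd_conv)
qed

lemma DERIV_partial2:
  assumes "(U :: pair \<Rightarrow> real) differentiable (at (x, y))"
  shows "((\<lambda>s. U (x, s)) has_real_derivative pd2 U (x, y)) (at y)"
proof -
  have "(U \<circ> (\<lambda>s. (x, s))) differentiable (at y)"
    by (rule differentiable_chain_at) (use assms in \<open>auto intro!: derivative_intros\<close>)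
  then show ?thesis
    unfolding pd2_def
    by (metis (no_types, lifting) DERIV_deriv_iff_real_differentiable comp_apply ext fst_conv snd_conv)
qed

text \<open>Allows a derivative in q1 to be computed from a closed formula that is valid only on the
  open set where the sine does not vanish.\<close>

lemma deriv_cong_open:
  assumes "(g has_real_derivative D) (at x)" "open W" "x \<in> W" "\<And>s. s \<in> W \<Longrightarrow> f s = g s"
  shows "deriv f x = D"
  by (rule DERIV_imp_deriv, rule has_field_derivative_transform_within_open[OF assms(1-3)])
    (simp add: assms(4))

locale sleigh =
  fixes m I a :: real and U :: "pair \<Rightarrow> real"
  assumes m_pos: "m > 0" and I_gt: "I > m * a\<^sup>2"
    and U_diff: "\<And>q. U differentiable (at q)"
begin

lemma I_pos: "I > 0"
  using m_pos I_gt by (smt (verit) mult_nonneg_nonneg zero_le_power2)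

text \<open>This is where I > m a^2 enters: since (cos(2x))^2 is at most 1, the discriminant is at
  least I - m a^2. It makes the reduced kinetic energy nondegenerate.\<close>

lemma disc_pos: "disc m I a x > 0"
proof -
  have "m * a\<^sup>2 * (cos (2 * x))\<^sup>2 \<le> m * a\<^sup>2 * 1"
    by (intro mult_left_mono) (use m_pos in \<open>auto simp: abs_square_le_1\<close>)
  then show ?thesis
    using I_gt by (simp add: disc_def)
qed

text \<open>Eliminating the third velocity turns 1 + cot^2 into 1 / sin^2 and -sin + cos^2 / sin
  into cos(2x) / sin; the latter is the origin of the double angle in all coefficients.\<close>

lemma Lstar_eq:
  assumes "sin x \<noteq> 0"
  shows "Lstar (sleigh_L m I a U) sleigh_a1 sleigh_a2 (x, y) (v1, v2) =
    m / (sin x)\<^sup>2 * v2\<^sup>2 / 2 + I * v1\<^sup>2 / 2 + m * a * cos (2 * x) / sin x * v1 * v2 - U (x, y)"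
proof -
  have 1: "v2\<^sup>2 + (cos x / sin x * v2)\<^sup>2 = v2\<^sup>2 / (sin x)\<^sup>2"
    using assms by (simp add: cos_squared_eq power_mult_distrib field_simps)
  have 2: "- v2 * sin x + cos x / sin x * v2 * cos x = cos (2 * x) / sin x * v2"
    unfolding cos_double using assms by (simp add: power2_eq_square field_simps)
  show ?thesis
    unfolding Lstar_def sleigh_L_def constr_v3_def sleigh_a1_def sleigh_a2_def
    using 1 2 by simp
qed

section \<open>The Legendre transform and the function S\<close>

lemma momentum_eq:
  assumes "sin x \<noteq> 0"
  shows "momentum (sleigh_L m I a U) sleigh_a1 sleigh_a2 (x, y) (v1, v2) =
    (I * v1 + m * a * cos (2 * x) / sin x * v2, m * a * cos (2 * x) / sin x * v1 + m / (sin x)\<^sup>2 * v2)"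
proof -
  have "pd1 (Lstar (sleigh_L m I a U) sleigh_a1 sleigh_a2 (x, y)) (v1, v2) = I * v1 + m * a * cos (2 * x) / sin x * v2"
    unfolding pd1_def Lstar_eq[OF assms] fst_conv snd_conv
    using assms by (intro DERIV_imp_deriv) (auto intro!: derivative_eq_intros)
  moreover have "pd2 (Lstar (sleigh_L m I a U) sleigh_a1 sleigh_a2 (x, y)) (v1, v2) = m * a * cos (2 * x) / sin x * v1 + m / (sin x)\<^sup>2 * v2"
    unfolding pd2_def Lstar_eq[OF assms] fst_conv snd_conv
    using assms by (intro DERIV_imp_deriv) (auto intro!: derivative_eq_intros simp: field_simps eval_nat_numeral)
  ultimately show ?thesis by (simp add: momentum_def)
qed

text \<open>Cramer's rule for the matrix with rows (I, \<beta>) and (\<beta>, \<alpha>). The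
  equivalence gives existence and uniqueness for the description in \<open>velocity\<close>, and
  later also that every velocity comes from some momenta.\<close>

lemma momentum_eq_iff:
  assumes s: "sin x \<noteq> 0"
  shows "momentum (sleigh_L m I a U) sleigh_a1 sleigh_a2 (x, y) (v1, v2) = (P1, P2) \<longleftrightarrow>
    v1 = coeff_A m I a x * P1 + coeff_B m I a x * P2 \<and> v2 = coeff_B m I a x * P1 + coeff_E m I a x * P2"
proof -
  define \<beta> where "\<beta> = m * a * cos (2 * x) / sin x"
  define \<alpha> where "\<alpha> = m / (sin x)\<^sup>2"
  have D: "I * \<alpha> - \<beta>\<^sup>2 = m * disc m I a x / (sin x)\<^sup>2"
    using s by (simp add: \<alpha>_def \<beta>_def disc_def field_simps power2_eq_square)
  then have D0: "I * \<alpha> - \<beta>\<^sup>2 \<noteq> 0"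
    using s disc_pos[of x] m_pos by simp
  have co: "coeff_A m I a x = \<alpha> / (I * \<alpha> - \<beta>\<^sup>2)" "coeff_B m I a x = - \<beta> / (I * \<alpha> - \<beta>\<^sup>2)"
    "coeff_E m I a x = I / (I * \<alpha> - \<beta>\<^sup>2)"
    unfolding D using s disc_pos[of x] m_pos
    by (auto simp: coeff_A_def coeff_B_def coeff_E_def \<alpha>_def \<beta>_def field_simps power2_eq_square)
  show ?thesis
    unfolding momentum_eq[OF s] \<beta>_def[symmetric] \<alpha>_def[symmetric] co prod.inject
  proof (intro iffI conjI; elim conjE)
    assume "I * v1 + \<beta> * v2 = P1" and "\<beta> * v1 + \<alpha> * v2 = P2"
    then show "v1 = \<alpha> / (I * \<alpha> - \<beta>\<^sup>2) * P1 + - \<beta> / (I * \<alpha> - \<beta>\<^sup>2) * P2"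
      "v2 = - \<beta> / (I * \<alpha> - \<beta>\<^sup>2) * P1 + I / (I * \<alpha> - \<beta>\<^sup>2) * P2"
      using D0 by (auto simp: divide_simps) (auto simp: algebra_simps power2_eq_square)
  next
    assume v: "v1 = \<alpha> / (I * \<alpha> - \<beta>\<^sup>2) * P1 + - \<beta> / (I * \<alpha> - \<beta>\<^sup>2) * P2"
      "v2 = - \<beta> / (I * \<alpha> - \<beta>\<^sup>2) * P1 + I / (I * \<alpha> - \<beta>\<^sup>2) * P2"
    show "I * v1 + \<beta> * v2 = P1" "\<beta> * v1 + \<alpha> * v2 = P2"
      unfolding v using D0 by (auto simp: divide_simps) (auto simp: algebra_simps power2_eq_square)
  qed
qed

lemma velocity_eq:
  assumes s: "sin x \<noteq> 0"
  shows "velocity (sleigh_L m I a U) sleigh_a1 sleigh_a2 (x, y) (P1, P2) =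
    (coeff_A m I a x * P1 + coeff_B m I a x * P2, coeff_B m I a x * P1 + coeff_E m I a x * P2)"
  unfolding velocity_def
  by (rule the_equality) (auto simp: momentum_eq_iff[OF s])

lemma Ham_eq:
  assumes s: "sin x \<noteq> 0"
  shows "sleigh_H m I a U (x, y) (P1, P2) =
    (coeff_A m I a x * P1\<^sup>2 + 2 * coeff_B m I a x * P1 * P2 + coeff_E m I a x * P2\<^sup>2) / 2 + U (x, y)"
proof -
  define v1 where "v1 = coeff_A m I a x * P1 + coeff_B m I a x * P2"
  define v2 where "v2 = coeff_B m I a x * P1 + coeff_E m I a x * P2"
  have "momentum (sleigh_L m I a U) sleigh_a1 sleigh_a2 (x, y) (v1, v2) = (P1, P2)"
    unfolding momentum_eq_iff[OF s] by (simp add: v1_def v2_def)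
  then have P: "P1 = I * v1 + m * a * cos (2 * x) / sin x * v2"
    "P2 = m * a * cos (2 * x) / sin x * v1 + m / (sin x)\<^sup>2 * v2"
    unfolding momentum_eq[OF s] by auto
  \<comment> \<open>Euler's identity: the kinetic energy is quadratic in the velocities, hence half
    the pairing of momenta and velocities. So H is the other half plus U, and the inverse matrix
    need not be squared.\<close>
  have "Lstar (sleigh_L m I a U) sleigh_a1 sleigh_a2 (x, y) (v1, v2) = (P1 * v1 + P2 * v2) / 2 - U (x, y)"
    unfolding Lstar_eq[OF s] P by (simp add: algebra_simps power2_eq_square)
  then show ?thesis
    unfolding Ham_def velocity_eq[OF s] Let_def v1_def[symmetric] v2_def[symmetric] fst_conv snd_conv
    by (simp add: v1_def v2_def field_simps power2_eq_square)
qed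

lemma S_eq:
  assumes s: "sin x \<noteq> 0"
  shows "sleigh_S m I a U (x, y) (P1, P2) = coeff_F m I a x * P1 + coeff_G m I a x * P2"
proof -
  define v1 where "v1 = coeff_A m I a x * P1 + coeff_B m I a x * P2"
  define v2 where "v2 = coeff_B m I a x * P1 + coeff_E m I a x * P2"
  have 1: "deriv (\<lambda>r. sleigh_L m I a U (x, y) (v1, v2, r)) w = m * w + m * a * v1 * cos x" for w
    unfolding sleigh_L_def
    by (intro DERIV_imp_deriv) (auto intro!: derivative_eq_intros)
  have 2: "pd2 sleigh_a1 (x, y) - pd1 sleigh_a2 (x, y) = 1 / (sin x)\<^sup>2"
  proof -
    have "((\<lambda>r. cos r / sin r) has_real_derivative (- sin x * sin x - cos x * cos x) / (sin x * sin x)) (at x)"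
      using s by (auto intro!: derivative_eq_intros)
    also have "- sin x * sin x - cos x * cos x = - 1"
      using sin_cos_squared_add3[of x] by linarith
    finally show ?thesis
      by (simp add: pd1_def pd2_def sleigh_a1_def sleigh_a2_def DERIV_imp_deriv power2_eq_square)
  qed
  \<comment> \<open>On the constraint, the derivative of L in the third velocity is m cot x times
    this combination. In the momenta it has the factor (sin x)^2, which leaves just one sine in the
    denominator of G.\<close>
  have "v2 + a * sin x * v1 = sin x * (a * (1 - cos (2 * x)) * P1 + sin x * (I / m - a\<^sup>2 * cos (2 * x)) * P2) / disc m I a x"
    using disc_pos[of x] m_pos
    by (simp add: v1_def v2_def coeff_A_def coeff_B_def coeff_E_def field_simps power2_eq_square)
  also have "1 - cos (2 * x) = 2 * (sin x)\<^sup>2"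
    by (simp add: cos_double_sin)
  finally have 3: "v2 + a * sin x * v1 = (sin x)\<^sup>2 * (2 * a * sin x * P1 + (I / m - a\<^sup>2 * cos (2 * x)) * P2) / disc m I a x"
    by (simp add: algebra_simps power2_eq_square)
  have "sleigh_S m I a U (x, y) (P1, P2) = m * cos x / (sin x) ^ 3 * (v2 + a * sin x * v1)"
    unfolding S_fun_def S_vel_def velocity_eq[OF s] v1_def[symmetric] v2_def[symmetric] fst_conv snd_conv 1 2
    using s by (simp add: constr_v3_def sleigh_a1_def sleigh_a2_def field_simps power2_eq_square power3_eq_cube)
  also have "\<dots> = coeff_F m I a x * P1 + coeff_G m I a x * P2"
    unfolding 3 coeff_F_def coeff_G_def using s disc_pos[of x] m_pos
    by (simp add: field_simps power2_eq_square power3_eq_cube)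
  finally show ?thesis .
qed

text \<open>The derivatives stay unevaluated: in the divergence those of A and B cancel, and that of
  E does not occur.\<close>

lemma coeff_DERIV:
  "(coeff_A m I a has_real_derivative deriv (coeff_A m I a) x) (at x)"
  "(coeff_B m I a has_real_derivative deriv (coeff_B m I a) x) (at x)"
  "(coeff_E m I a has_real_derivative deriv (coeff_E m I a) x) (at x)"
proof -
  have d: "(\<lambda>x. disc m I a x) differentiable (at x)"
    unfolding disc_def real_differentiable_def
    by (rule exI, (rule derivative_eq_intros refl)+)
  have *: "cos differentiable (at x)" "sin differentiable (at x)" "(\<lambda>x. cos (2 * x)) differentiable (at x)" for x :: real
    unfolding real_differentiable_def by (auto intro!: derivative_eq_intros exI)
  have n: "disc m I a x \<noteq> 0" "m * disc m I a x \<noteq> 0" using disc_pos[of x] m_pos by auto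
  show "(coeff_A m I a has_real_derivative deriv (coeff_A m I a) x) (at x)"
    "(coeff_B m I a has_real_derivative deriv (coeff_B m I a) x) (at x)"
    "(coeff_E m I a has_real_derivative deriv (coeff_E m I a) x) (at x)"
    unfolding DERIV_deriv_iff_real_differentiable coeff_A_def[abs_def] coeff_B_def[abs_def] coeff_E_def[abs_def]
    using d n * by (auto intro!: differentiable_divide differentiable_mult differentiable_power)
qed

section \<open>The vector field and the divergence of its multiples\<close>

lemma field_eq:
  assumes s: "sin x \<noteq> 0"
  shows "sleigh_field m I a U ((x, y), (P1, P2)) =
   (let v1 = coeff_A m I a x * P1 + coeff_B m I a x * P2;
        v2 = coeff_B m I a x * P1 + coeff_E m I a x * P2;
        S = coeff_F m I a x * P1 + coeff_G m I a x * P2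
    in ((v1, v2),
        (- ((deriv (coeff_A m I a) x * P1\<^sup>2 + 2 * deriv (coeff_B m I a) x * P1 * P2 + deriv (coeff_E m I a) x * P2\<^sup>2) / 2
             + pd1 U (x, y)) + v2 * S,
         - pd2 U (x, y) - v1 * S)))"
proof -
  have 1: "pd1 (sleigh_H m I a U (x, y)) (P1, P2) = coeff_A m I a x * P1 + coeff_B m I a x * P2"
    unfolding pd1_def fst_conv snd_conv Ham_eq[OF s]
    by (intro DERIV_imp_deriv) (auto intro!: derivative_eq_intros)
  have 2: "pd2 (sleigh_H m I a U (x, y)) (P1, P2) = coeff_B m I a x * P1 + coeff_E m I a x * P2"
    unfolding pd2_def fst_conv snd_conv Ham_eq[OF s]
    by (intro DERIV_imp_deriv) (auto intro!: derivative_eq_intros)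
  have 3: "pd1 (\<lambda>q'. sleigh_H m I a U q' (P1, P2)) (x, y) =
    (deriv (coeff_A m I a) x * P1\<^sup>2 + 2 * deriv (coeff_B m I a) x * P1 * P2 + deriv (coeff_E m I a) x * P2\<^sup>2) / 2 + pd1 U (x, y)"
    unfolding pd1_def fst_conv snd_conv
  proof (rule deriv_cong_open[OF _ open_sin_nz])
    show "((\<lambda>r. (coeff_A m I a r * P1\<^sup>2 + 2 * coeff_B m I a r * P1 * P2 + coeff_E m I a r * P2\<^sup>2) / 2 + U (r, y)) has_real_derivative
      (deriv (coeff_A m I a) x * P1\<^sup>2 + 2 * deriv (coeff_B m I a) x * P1 * P2 + deriv (coeff_E m I a) x * P2\<^sup>2) / 2
        + deriv (\<lambda>s. U (s, y)) x) (at x)"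
      using DERIV_partial1[OF U_diff[of "(x, y)"]] unfolding pd1_def fst_conv snd_conv
      by (auto intro!: derivative_eq_intros coeff_DERIV simp: field_simps)
  qed (use s Ham_eq in auto)
  have 4: "pd2 (\<lambda>q'. sleigh_H m I a U q' (P1, P2)) (x, y) = pd2 U (x, y)"
    unfolding pd2_def fst_conv snd_conv Ham_eq[OF s]
    using DERIV_partial2[OF U_diff[of "(x, y)"]] unfolding pd2_def fst_conv snd_conv
    by (intro DERIV_imp_deriv) (auto intro!: derivative_eq_intros)
  show ?thesis
    unfolding reduced_field_def case_prod_conv Let_def 1 2 3 4 S_eq[OF s] ..
qed

text \<open>As in Liouville's theorem, the mixed second derivatives of H cancel, and so do the two
  terms B S. What survives is the derivative of N along the velocity and N times v2 dS/dP1 - v1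
  dS/dP2.\<close>

lemma phase_div_field:
  assumes s: "sin x \<noteq> 0"
    and N1: "((\<lambda>r. N (r, y)) has_real_derivative N1) (at x)"
    and N2: "((\<lambda>r. N (x, r)) has_real_derivative N2) (at y)"
  shows "phase_div (\<lambda>z. N (fst z) *\<^sub>R sleigh_field m I a U z) ((x, y), (P1, P2)) =
    (let v1 = coeff_A m I a x * P1 + coeff_B m I a x * P2; v2 = coeff_B m I a x * P1 + coeff_E m I a x * P2
     in N1 * v1 + N2 * v2 + N (x, y) * (v2 * coeff_F m I a x - v1 * coeff_G m I a x))"
proof -
  have 1: "deriv (\<lambda>r. fst (fst (N (fst ((r, y), (P1, P2))) *\<^sub>R sleigh_field m I a U ((r, y), (P1, P2))))) x =
     N1 * (coeff_A m I a x * P1 + coeff_B m I a x * P2) + N (x, y) * (deriv (coeff_A m I a) x * P1 + deriv (coeff_B m I a) x * P2)"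
  proof (rule deriv_cong_open[OF _ open_sin_nz])
    show "((\<lambda>r. N (r, y) * (coeff_A m I a r * P1 + coeff_B m I a r * P2)) has_real_derivative
      N1 * (coeff_A m I a x * P1 + coeff_B m I a x * P2) + N (x, y) * (deriv (coeff_A m I a) x * P1 + deriv (coeff_B m I a) x * P2)) (at x)"
      using N1 by (auto intro!: derivative_eq_intros coeff_DERIV simp: field_simps)
  qed (use s in \<open>auto simp: field_eq Let_def\<close>)
  have 2: "deriv (\<lambda>r. snd (fst (N (fst ((x, r), (P1, P2))) *\<^sub>R sleigh_field m I a U ((x, r), (P1, P2))))) y =
     N2 * (coeff_B m I a x * P1 + coeff_E m I a x * P2)"
    using N2 by (intro DERIV_imp_deriv) (auto simp: field_eq[OF s] Let_def intro!: derivative_eq_intros)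
  have 3: "deriv (\<lambda>r. fst (snd (N (fst ((x, y), (r, P2))) *\<^sub>R sleigh_field m I a U ((x, y), (r, P2))))) P1 =
     N (x, y) * (- (deriv (coeff_A m I a) x * P1 + deriv (coeff_B m I a) x * P2) + coeff_B m I a x * (coeff_F m I a x * P1 + coeff_G m I a x * P2)
       + (coeff_B m I a x * P1 + coeff_E m I a x * P2) * coeff_F m I a x)"
    by (intro DERIV_imp_deriv) (auto simp: field_eq[OF s] Let_def field_simps intro!: derivative_eq_intros)
  have 4: "deriv (\<lambda>r. snd (snd (N (fst ((x, y), (P1, r))) *\<^sub>R sleigh_field m I a U ((x, y), (P1, r))))) P2 =
     N (x, y) * (- coeff_B m I a x * (coeff_F m I a x * P1 + coeff_G m I a x * P2) - (coeff_A m I a x * P1 + coeff_B m I a x * P2) * coeff_G m I a x)"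
    by (intro DERIV_imp_deriv) (auto simp: field_eq[OF s] Let_def field_simps intro!: derivative_eq_intros)
  show ?thesis
    unfolding phase_div_def case_prod_conv pd1_def pd2_def prod.sel Let_def
    using 1 2 3 4 unfolding prod.sel by (simp add: algebra_simps)
qed

end

section \<open>Invariant densities and solutions\<close>

lemma smooth_on_differentiable: "smooth_on S f \<Longrightarrow> x \<in> S \<Longrightarrow> f differentiable (at x)"
  unfolding smooth_on_def by (metis Ck_on.simps(2))

lemma has_vector_derivative_phase_iff:
  "(\<gamma> has_vector_derivative ((d1, d2), (d3, d4))) (at t) \<longleftrightarrow>
    ((\<lambda>t. fst (fst (\<gamma> t))) has_real_derivative d1) (at t) \<and>
    ((\<lambda>t. snd (fst (\<gamma> t))) has_real_derivative d2) (at t) \<and>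
    ((\<lambda>t. fst (snd (\<gamma> t))) has_real_derivative d3) (at t) \<and>
    ((\<lambda>t. snd (snd (\<gamma> t))) has_real_derivative d4) (at t)"
  (is "?L \<longleftrightarrow> ?R")
proof
  assume L: ?L
  note f = bounded_linear.has_vector_derivative[OF bounded_linear_fst]
    and s = bounded_linear.has_vector_derivative[OF bounded_linear_snd]
  show ?R
    using f[OF f[OF L]] s[OF f[OF L]] f[OF s[OF L]] s[OF s[OF L]]
    by (simp add: has_real_derivative_iff_has_vector_derivative)
next
  assume ?R
  then have "((\<lambda>t. ((fst (fst (\<gamma> t)), snd (fst (\<gamma> t))), (fst (snd (\<gamma> t)), snd (snd (\<gamma> t))))) has_vector_derivative
    ((d1, d2), (d3, d4))) (at t)"
    by (intro has_vector_derivative_Pair) (simp_all add: has_real_derivative_iff_has_vector_derivative)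
  then show ?L by simp
qed

context sleigh
begin

section \<open>The obstruction to an invariant density for nonzero \<open>a\<close>\<close>

lemma S_condition_eq:
  assumes s: "sin x \<noteq> 0"
  shows "pd1 (\<lambda>q'. pd1 (sleigh_S m I a U q') P) (x, y) + pd2 (\<lambda>q'. pd2 (sleigh_S m I a U q') P) (x, y) =
    deriv (coeff_F m I a) x"
proof -
  obtain P1 P2 where P: "P = (P1, P2)" by fastforce
  have 1: "pd1 (sleigh_S m I a U (r, y)) P = coeff_F m I a r" if "sin r \<noteq> 0" for r y
    unfolding pd1_def P fst_conv snd_conv S_eq[OF that]
    by (intro DERIV_imp_deriv) (auto intro!: derivative_eq_intros)
  have 2: "pd2 (sleigh_S m I a U (r, y)) P = coeff_G m I a r" if "sin r \<noteq> 0" for r y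
    unfolding pd2_def P fst_conv snd_conv S_eq[OF that]
    by (intro DERIV_imp_deriv) (auto intro!: derivative_eq_intros)
  have "pd1 (\<lambda>q'. pd1 (sleigh_S m I a U q') P) (x, y) = deriv (coeff_F m I a) x"
    unfolding pd1_def[of _ "(x, y)"] fst_conv snd_conv
  proof (rule deriv_cong_ev)
    show "\<forall>\<^sub>F r in nhds x. pd1 (sleigh_S m I a U (r, y)) P = coeff_F m I a r"
      using eventually_nhds_in_open[OF open_sin_nz, of x] s 1 by (auto elim!: eventually_mono)
  qed simp
  moreover have "pd2 (\<lambda>q'. pd2 (sleigh_S m I a U q') P) (x, y) = 0"
    unfolding pd2_def[of _ "(x, y)"] fst_conv snd_conv 2[OF s] by simp
  ultimately show ?thesis by simp
qed

text \<open>At a zero of the cosine the quotient rule loses the term with the derivative of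
  \<open>disc\<close>, which therefore need not be known; -2 m a sin x / disc remains.\<close>

lemma deriv_coeff_F_nonzero:
  assumes "a \<noteq> 0" "cos x = 0" "sin x \<noteq> 0"
  shows "deriv (coeff_F m I a) x \<noteq> 0"
proof -
  have "(\<lambda>x. disc m I a x) differentiable (at x)"
    unfolding disc_def real_differentiable_def
    by (rule exI, (rule derivative_eq_intros refl)+)
  then obtain D where D: "(disc m I a has_real_derivative D) (at x)"
    by (auto simp: real_differentiable_def)
  have "(coeff_F m I a has_real_derivative (2 * m * a * (- sin x) * disc m I a x - 2 * m * a * cos x * D) / (disc m I a x * disc m I a x)) (at x)"
    unfolding coeff_F_def[abs_def] using disc_pos[of x]
    by (auto intro!: derivative_eq_intros D)
  from DERIV_imp_deriv[OF this] show ?thesis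
    using assms disc_pos[of x] m_pos by simp
qed

text \<open>At a fixed position the divergence is linear in the velocity. As all velocities are
  attained, its vanishing for all momenta can be tested at the two unit velocities, which separates
  the two gradient equations.\<close>

lemma momentum_surj:
  assumes "sin x \<noteq> 0"
  shows "\<exists>P1 P2. v1 = coeff_A m I a x * P1 + coeff_B m I a x * P2 \<and> v2 = coeff_B m I a x * P1 + coeff_E m I a x * P2"
  using momentum_eq_iff[OF assms] by (metis surj_pair)

lemma invariant_density_gradient:
  assumes inv: "invariant_density_on (J \<times> UNIV) (sleigh_field m I a U) N"
    and x: "x \<in> J" "sin x \<noteq> 0" and N: "N differentiable (at (x, y))"
  shows "pd1 N (x, y) = N (x, y) * coeff_G m I a x" "pd2 N (x, y) = - N (x, y) * coeff_F m I a x"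
proof -
  have *: "pd1 N (x, y) * v1 + pd2 N (x, y) * v2 + N (x, y) * (v2 * coeff_F m I a x - v1 * coeff_G m I a x) = 0" for v1 v2
  proof -
    from momentum_surj[OF x(2)] obtain P1 P2 where
      P: "v1 = coeff_A m I a x * P1 + coeff_B m I a x * P2" "v2 = coeff_B m I a x * P1 + coeff_E m I a x * P2" by blast
    have "phase_div (\<lambda>z. N (fst z) *\<^sub>R sleigh_field m I a U z) ((x, y), (P1, P2)) = 0"
      using inv x(1) unfolding invariant_density_on_def by auto
    then show ?thesis
      unfolding phase_div_field[OF x(2) DERIV_partial1[OF N] DERIV_partial2[OF N]] Let_def P[symmetric] .
  qed
  show "pd1 N (x, y) = N (x, y) * coeff_G m I a x" using *[of 1 0] by simp
  show "pd2 N (x, y) = - N (x, y) * coeff_F m I a x" using *[of 0 1] by simp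
qed

text \<open>By the two gradient equations, \<open>ln N (x, y) - ln N (x, 0)\<close> is constant in \<open>x\<close> and has the
  \<open>y\<close>-derivative \<open>- coeff_F m I a x\<close>; but \<open>coeff_F m I a\<close> is not constant.\<close>

lemma no_invariant_density:
  assumes a: "a \<noteq> 0" and x: "x0 < x1" "{x0..x1} \<subseteq> J" "cos x0 \<noteq> 0" "cos x1 = 0"
    and J: "\<And>x. x \<in> J \<Longrightarrow> sin x \<noteq> 0"
    and N: "smooth_on (J \<times> UNIV) N" "\<forall>q \<in> J \<times> UNIV. N q > 0"
  shows "\<not> invariant_density_on (J \<times> UNIV) (sleigh_field m I a U) N"
proof
  assume inv: "invariant_density_on (J \<times> UNIV) (sleigh_field m I a U) N"
  have pos: "N (x, y) > 0" if "x \<in> J" for x y using N(2) that by auto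
  have diff: "N differentiable (at (x, y))" if "x \<in> J" for x y
    using smooth_on_differentiable[OF N(1)] that by auto
  note grad = invariant_density_gradient[OF inv _ J diff]
  have d1: "((\<lambda>x. ln (N (x, y))) has_real_derivative coeff_G m I a x) (at x)" if "x \<in> J" for x y
    using DERIV_chain2[OF DERIV_ln[OF pos[OF that]] DERIV_partial1[OF diff[OF that, of y]]]
      pos[OF that, of y] by (simp add: grad[OF that that that] field_simps)
  have d2: "((\<lambda>y. ln (N (x, y))) has_real_derivative - coeff_F m I a x) (at y)" if "x \<in> J" for x y
    using DERIV_chain2[OF DERIV_ln[OF pos[OF that]] DERIV_partial2[OF diff[OF that, of y]]]
      pos[OF that, of y] by (simp add: grad[OF that that that] field_simps)
  \<comment> \<open>G depends on x only, so it is the same at heights y and 0 and cancels in the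
    difference.\<close>
  have d0: "((\<lambda>x. ln (N (x, y)) - ln (N (x, 0))) has_real_derivative 0) (at x)" if "x \<in> J" for x y
    using DERIV_diff[OF d1[OF that, of y] d1[OF that, of 0]] by simp
  have eq: "ln (N (x1, y)) - ln (N (x1, 0)) = ln (N (x0, y)) - ln (N (x0, 0))" for y
  proof (rule DERIV_isconst_end[OF x(1)])
    show "continuous_on {x0..x1} (\<lambda>x. ln (N (x, y)) - ln (N (x, 0)))"
      using d0 x(2) by (meson DERIV_isCont continuous_at_imp_continuous_on subsetD)
  qed (use d0 x(2) in \<open>auto simp: subset_iff\<close>)
  have in_J: "x0 \<in> J" "x1 \<in> J" using x by auto
  have "((\<lambda>y. ln (N (x0, y)) - ln (N (x0, 0))) has_real_derivative - coeff_F m I a x0) (at 0)"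
    by (rule DERIV_cong[OF DERIV_diff[OF d2[OF in_J(1)] DERIV_const]]) simp
  moreover have "((\<lambda>y. ln (N (x1, y)) - ln (N (x1, 0))) has_real_derivative - coeff_F m I a x1) (at 0)"
    by (rule DERIV_cong[OF DERIV_diff[OF d2[OF in_J(2)] DERIV_const]]) simp
  ultimately have "coeff_F m I a x0 = coeff_F m I a x1"
    unfolding eq using DERIV_unique by fastforce
  then show False
    \<comment> \<open>F vanishes at x1 together with the cosine, but not at x0.\<close>
    using a x disc_pos[of x0] m_pos by (simp add: coeff_F_def)
qed

lemma deriv_coeff_F_zero_iff:
  assumes "x1 \<in> J" "cos x1 = 0" and J: "\<And>x. x \<in> J \<Longrightarrow> sin x \<noteq> 0"
  shows "(\<forall>q \<in> J \<times> UNIV. \<forall>P. pd1 (\<lambda>q'. pd1 (sleigh_S m I a U q') P) q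
     + pd2 (\<lambda>q'. pd2 (sleigh_S m I a U q') P) q = 0) \<longleftrightarrow> a = 0" (is "?L \<longleftrightarrow> _")
proof
  assume ?L
  then have "deriv (coeff_F m I a) x1 = 0"
    using S_condition_eq[OF J[OF assms(1)]] assms(1) by fastforce
  then show "a = 0" using deriv_coeff_F_nonzero assms by blast
next
  assume "a = 0"
  then have "coeff_F m I a = (\<lambda>x. 0)" by (simp add: coeff_F_def fun_eq_iff)
  then have "deriv (coeff_F m I a) x = 0" for x by simp
  then show ?L using S_condition_eq J by auto
qed

section \<open>The case \<open>a = 0\<close>: invariant density and conformally Hamiltonian
  form\<close>

lemma coeffs_a_zero:
  assumes "a = 0"
  shows "coeff_A m I a = (\<lambda>x. 1 / I)" "coeff_B m I a = (\<lambda>x. 0)" "coeff_E m I a = (\<lambda>x. (sin x)\<^sup>2 / m)"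
    "coeff_F m I a = (\<lambda>x. 0)" "coeff_G m I a = (\<lambda>x. cos x / sin x)"
  using assms I_pos by (auto simp: coeff_A_def coeff_B_def coeff_E_def coeff_F_def coeff_G_def disc_def)

lemma sleigh_N_invariant:
  assumes "a = 0"
  shows "invariant_density_on ({q1. sin q1 \<noteq> 0} \<times> UNIV) (sleigh_field m I a U) sleigh_N"
  unfolding invariant_density_on_def
proof (intro ballI allI)
  fix q :: pair and P :: pair
  assume q: "q \<in> {q1. sin q1 \<noteq> 0} \<times> UNIV"
  obtain x y P1 P2 where xy: "q = (x, y)" "P = (P1, P2)" by (metis surj_pair)
  have s: "sin x \<noteq> 0" using q xy by simp
  have "((\<lambda>r. sleigh_N (r, y)) has_real_derivative cos x) (at x)"
    "((\<lambda>r. sleigh_N (x, r)) has_real_derivative 0) (at y)"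
    by (auto simp: sleigh_N_def intro!: derivative_eq_intros)
  from phase_div_field[OF s this]
  show "phase_div (\<lambda>z. sleigh_N (fst z) *\<^sub>R sleigh_field m I a U z) (q, P) = 0"
    unfolding xy Let_def coeffs_a_zero[OF assms] using s by (simp add: sleigh_N_def)
qed

lemma Ham_a_zero:
  assumes "a = 0" "sin (fst q) \<noteq> 0"
  shows "sleigh_H m I a U q P = sleigh_Hbar m I U (q, sleigh_N q *\<^sub>R P)"
proof -
  obtain x y P1 P2 where xy: "q = (x, y)" "P = (P1, P2)" by (metis surj_pair)
  have s: "sin x \<noteq> 0" using assms xy by simp
  show ?thesis
    unfolding xy Ham_eq[OF s] coeffs_a_zero[OF assms(1)]
    using s by (simp add: sleigh_Hbar_def sleigh_N_def power_mult_distrib field_simps)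
qed

text \<open>In the first momentum equation the reaction term v2 S equals sin x cos x P2^2 / m and
  cancels the force from the derivative of E; only the potential force is left.\<close>

lemma field_a_zero:
  assumes "a = 0" "sin x \<noteq> 0"
  shows "sleigh_field m I a U ((x, y), (P1, P2)) =
    ((P1 / I, (sin x)\<^sup>2 * P2 / m), (- pd1 U (x, y), - pd2 U (x, y) - P1 * P2 * cos x / (I * sin x)))"
proof -
  have "deriv (\<lambda>x. (sin x)\<^sup>2 / m) x = 2 * sin x * cos x / m"
    by (intro DERIV_imp_deriv) (use m_pos in \<open>auto intro!: derivative_eq_intros\<close>)
  then show ?thesis
    unfolding field_eq[OF assms(2)] Let_def coeffs_a_zero[OF assms(1)]
    using assms(2) m_pos I_pos by (simp add: field_simps power2_eq_square)
qed

lemma conf_ham_sleigh: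
  assumes "sin x \<noteq> 0"
  shows "conf_ham_field sleigh_N (sleigh_Hbar m I U) ((x, y), (p1, p2)) =
    ((p1 / (I * sin x), sin x * p2 / m), (p1\<^sup>2 * cos x / (I * (sin x)\<^sup>2) - sin x * pd1 U (x, y), - (sin x * pd2 U (x, y))))"
proof -
  have 1: "pd1 (\<lambda>p'. sleigh_Hbar m I U ((x, y), p')) (p1, p2) = p1 / (I * (sin x)\<^sup>2)"
    unfolding pd1_def sleigh_Hbar_def case_prod_conv fst_conv snd_conv
    by (intro DERIV_imp_deriv) (use assms I_pos in \<open>auto intro!: derivative_eq_intros simp: field_simps\<close>)
  have 2: "pd2 (\<lambda>p'. sleigh_Hbar m I U ((x, y), p')) (p1, p2) = p2 / m"
    unfolding pd2_def sleigh_Hbar_def case_prod_conv fst_conv snd_conv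
    by (intro DERIV_imp_deriv) (use m_pos in \<open>auto intro!: derivative_eq_intros simp: field_simps\<close>)
  have 3: "pd1 (\<lambda>q'. sleigh_Hbar m I U (q', (p1, p2))) (x, y) = - p1\<^sup>2 * cos x / (I * (sin x) ^ 3) + pd1 U (x, y)"
    unfolding pd1_def sleigh_Hbar_def case_prod_conv fst_conv snd_conv
    using DERIV_partial1[OF U_diff[of "(x, y)"]] unfolding pd1_def fst_conv snd_conv
    by (intro DERIV_imp_deriv)
      (use assms I_pos in \<open>auto intro!: derivative_eq_intros simp: field_simps power2_eq_square power3_eq_cube\<close>)
  have 4: "pd2 (\<lambda>q'. sleigh_Hbar m I U (q', (p1, p2))) (x, y) = pd2 U (x, y)"
    unfolding pd2_def sleigh_Hbar_def case_prod_conv fst_conv snd_conv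
    using DERIV_partial2[OF U_diff[of "(x, y)"]] unfolding pd2_def fst_conv snd_conv
    by (intro DERIV_imp_deriv) (auto intro!: derivative_eq_intros)
  show ?thesis
    unfolding conf_ham_field_def case_prod_conv 1 2 3 4 sleigh_N_def
    using assms I_pos by (simp add: field_simps power2_eq_square power3_eq_cube)
qed

text \<open>Both systems contain the same equation for q1, which fixes the derivative of sin q1
  along the curve. Given it, the product rule carries the equations for P to those for p, and the
  quotient rule carries them back. In the second one the term from S is exactly what the derivative
  of the multiplier absorbs.\<close>

lemma solves_on_a_zero:
  assumes a: "a = 0" and T: "open T" "\<And>t. t \<in> T \<Longrightarrow> sin (fst (fst (\<gamma> t))) \<noteq> 0"
  shows "solves_on (sleigh_field m I a U) T \<gamma> \<longleftrightarrow>
    solves_on (conf_ham_field sleigh_N (sleigh_Hbar m I U)) T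
      (\<lambda>t. (fst (\<gamma> t), sleigh_N (fst (\<gamma> t)) *\<^sub>R snd (\<gamma> t)))"
  unfolding solves_on_def
proof (rule ball_cong[OF refl])
  fix t assume t: "t \<in> T"
  define X Y P1 P2 where XY: "X = (\<lambda>t. fst (fst (\<gamma> t)))" "Y = (\<lambda>t. snd (fst (\<gamma> t)))"
    "P1 = (\<lambda>t. fst (snd (\<gamma> t)))" "P2 = (\<lambda>t. snd (snd (\<gamma> t)))"
  have \<gamma>: "\<gamma> t = ((X t, Y t), (P1 t, P2 t))" for t by (simp add: XY)
  have s: "sin (X t) \<noteq> 0" if "t \<in> T" for t using T(2)[OF that] by (simp add: XY)
  note s0 = s[OF t]
  define u1 u2 where u: "u1 = pd1 U (X t, Y t)" "u2 = pd2 U (X t, Y t)"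
  have "(\<gamma> has_vector_derivative sleigh_field m I a U (\<gamma> t)) (at t) \<longleftrightarrow>
    (X has_real_derivative P1 t / I) (at t) \<and>
    (Y has_real_derivative (sin (X t))\<^sup>2 * P2 t / m) (at t) \<and>
    (P1 has_real_derivative - u1) (at t) \<and>
    (P2 has_real_derivative - u2 - P1 t * P2 t * cos (X t) / (I * sin (X t))) (at t)" (is "_ \<longleftrightarrow> ?X \<and> ?Y \<and> ?P1 \<and> ?P2")
    unfolding \<gamma> field_a_zero[OF a s0] has_vector_derivative_phase_iff fst_conv snd_conv u ..
  moreover have "((\<lambda>t. (fst (\<gamma> t), sleigh_N (fst (\<gamma> t)) *\<^sub>R snd (\<gamma> t))) has_vector_derivative
      conf_ham_field sleigh_N (sleigh_Hbar m I U) (fst (\<gamma> t), sleigh_N (fst (\<gamma> t)) *\<^sub>R snd (\<gamma> t))) (at t) \<longleftrightarrow>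
    (X has_real_derivative P1 t / I) (at t) \<and>
    (Y has_real_derivative (sin (X t))\<^sup>2 * P2 t / m) (at t) \<and>
    ((\<lambda>t. sin (X t) * P1 t) has_real_derivative (P1 t)\<^sup>2 * cos (X t) / I - sin (X t) * u1) (at t) \<and>
    ((\<lambda>t. sin (X t) * P2 t) has_real_derivative - (sin (X t) * u2)) (at t)" (is "_ \<longleftrightarrow> ?X \<and> ?Y \<and> ?p1 \<and> ?p2")
    unfolding \<gamma> sleigh_N_def fst_conv snd_conv scaleR_Pair real_scaleR_def conf_ham_sleigh[OF s0]
      has_vector_derivative_phase_iff u
    using s0 by (simp add: power_mult_distrib power2_eq_square mult.assoc)
  moreover have sX: "((\<lambda>t. sin (X t)) has_real_derivative cos (X t) * (P1 t / I)) (at t)" if X: ?X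
    using DERIV_chain2[OF DERIV_sin X] .
  moreover have "?P1 \<longleftrightarrow> ?p1" if X: ?X
  proof
    assume ?P1
    then show ?p1
      using X by (auto intro!: derivative_eq_intros simp: power2_eq_square)
  next
    assume p: ?p1
    \<comment> \<open>The quotient equals \<open>P1\<close> on all of \<open>T\<close>, where the
      sine does not vanish; openness of \<open>T\<close> then transfers the derivative.\<close>
    have "((\<lambda>t. sin (X t) * P1 t / sin (X t)) has_real_derivative - u1) (at t)"
      by (rule DERIV_cong[OF DERIV_divide[OF p sX[OF X] s0]]) (use s0 I_pos in \<open>simp add: field_simps power2_eq_square\<close>)
    then show ?P1
      by (rule has_field_derivative_transform_within_open[OF _ T(1) t]) (use s in auto)
  qed
  moreover have "?P2 \<longleftrightarrow> ?p2" if X: ?X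
  proof
    assume ?P2
    then show ?p2
      using X s0 I_pos by (auto intro!: derivative_eq_intros simp: field_simps)
  next
    assume p: ?p2
    have "((\<lambda>t. sin (X t) * P2 t / sin (X t)) has_real_derivative
        - u2 - P1 t * P2 t * cos (X t) / (I * sin (X t))) (at t)"
      by (rule DERIV_cong[OF DERIV_divide[OF p sX[OF X] s0]]) (use s0 I_pos in \<open>simp add: field_simps power2_eq_square\<close>)
    then show ?P2
      by (rule has_field_derivative_transform_within_open[OF _ T(1) t]) (use s in auto)
  qed
  ultimately show "(\<gamma> has_vector_derivative sleigh_field m I a U (\<gamma> t)) (at t) \<longleftrightarrow>
    ((\<lambda>t. (fst (\<gamma> t), sleigh_N (fst (\<gamma> t)) *\<^sub>R snd (\<gamma> t))) has_vector_derivative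
      conf_ham_field sleigh_N (sleigh_Hbar m I U) (fst (\<gamma> t), sleigh_N (fst (\<gamma> t)) *\<^sub>R snd (\<gamma> t))) (at t)"
    by blast
qed

end

theorem mainTheorem6:
  fixes m I a :: real and U :: "real \<times> real \<Rightarrow> real"
  assumes m_pos: "m > 0" and I_pos: "I > 0" and I_gt: "I > m * a\<^sup>2"
    and U_smooth: "smooth_on UNIV U"
    and U_angle: "\<And>q1 q2. U (q1 + 2 * pi, q2) = U (q1, q2)"
  shows
    "(\<forall>J \<in> {{q1. sin q1 \<noteq> 0}, {0<..<pi}, {pi<..<2 * pi}}.
        ((\<forall>q \<in> J \<times> UNIV. \<forall>P.
            pd1 (\<lambda>q'. pd1 (sleigh_S m I a U q') P) q
            + pd2 (\<lambda>q'. pd2 (sleigh_S m I a U q') P) q = 0) \<longleftrightarrow> a = 0)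
        \<and> (a \<noteq> 0 \<longrightarrow>
            \<not> (\<exists>N. smooth_on (J \<times> UNIV) N \<and> (\<forall>q \<in> J \<times> UNIV. N q > 0)
                 \<and> invariant_density_on (J \<times> UNIV) (sleigh_field m I a U) N)))
     \<and> (a = 0 \<longrightarrow>
          invariant_density_on ({q1. sin q1 \<noteq> 0} \<times> UNIV) (sleigh_field m I a U) sleigh_N
        \<and> (\<forall>q P. sin (fst q) \<noteq> 0 \<longrightarrow>
              sleigh_H m I a U q P = sleigh_Hbar m I U (q, sleigh_N q *\<^sub>R P))
        \<and> (\<forall>T \<gamma>. open T \<and> is_interval T \<and> (\<forall>t\<in>T. sin (fst (fst (\<gamma> t))) \<noteq> 0) \<longrightarrow>
              (solves_on (sleigh_field m I a U) T \<gamma> \<longleftrightarrow>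
               solves_on (conf_ham_field sleigh_N (sleigh_Hbar m I U)) T
                 (\<lambda>t. (fst (\<gamma> t), sleigh_N (fst (\<gamma> t)) *\<^sub>R snd (\<gamma> t))))))
     \<and> (a = 0 \<longrightarrow>
          (\<forall>C \<in> {{0<..<pi}, {pi<..<2 * pi}}.
             canonical_on ((C \<times> UNIV) \<times> UNIV) (sleigh_change m I)
           \<and> (\<forall>z \<in> (C \<times> UNIV) \<times> UNIV.
                sleigh_Hbar m I U z
                = point_H m (point_V m I U C) (sleigh_change m I z))))"
proof -
  have Ud: "U differentiable (at q)" for q
    using smooth_on_differentiable[OF U_smooth] by simp
  interpret sleigh m I a U
    by unfold_locales (use m_pos I_gt Ud in auto)
  have part1: "((\<forall>q \<in> J \<times> UNIV. \<forall>P.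
            pd1 (\<lambda>q'. pd1 (sleigh_S m I a U q') P) q
            + pd2 (\<lambda>q'. pd2 (sleigh_S m I a U q') P) q = 0) \<longleftrightarrow> a = 0)
        \<and> (a \<noteq> 0 \<longrightarrow>
            \<not> (\<exists>N. smooth_on (J \<times> UNIV) N \<and> (\<forall>q \<in> J \<times> UNIV. N q > 0)
                 \<and> invariant_density_on (J \<times> UNIV) (sleigh_field m I a U) N))"
    if J: "J \<in> {{q1. sin q1 \<noteq> 0}, {0<..<pi}, {pi<..<2 * pi}}" for J
  proof -
    have sin_nz: "sin x \<noteq> 0" if "x \<in> J" for x
      using J that sin_gt_zero[of x] sin_lt_zero[of x] by auto
    \<comment> \<open>The points pi/4 and pi/2, shifted by pi for the second component; the whole
      domain contains (0, pi), so the unshifted pair serves there as well. The segment must avoid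
      the zeros of the sine, and x1 is a zero of the cosine as both halves of (1) require.\<close>
    obtain x0 x1 where x: "x0 < x1" "{x0..x1} \<subseteq> J" "cos x0 \<noteq> 0" "cos x1 = 0"
    proof (cases "J = {pi<..<2 * pi}")
      case True
      have "cos (pi / 4 + pi) \<noteq> 0" "cos (pi / 2 + pi) = 0"
        by (simp_all only: cos_periodic_pi cos_45 cos_pi_half) simp_all
      moreover have "{pi / 4 + pi..pi / 2 + pi} \<subseteq> J"
        unfolding True using pi_gt_zero
        by (intro subsetI) (simp only: atLeastAtMost_iff greaterThanLessThan_iff, linarith)
      ultimately show thesis
        by (intro that[of "pi / 4 + pi" "pi / 2 + pi"]) auto
    next
      case False
      then have "{0<..<pi} \<subseteq> J"
        using J sin_gt_zero by fastforce
      moreover have "{pi / 4..pi / 2} \<subseteq> {0<..<pi}"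
        using pi_gt_zero by (intro subsetI) (simp only: atLeastAtMost_iff greaterThanLessThan_iff, linarith)
      ultimately have "{pi / 4..pi / 2} \<subseteq> J" by (rule order_trans[rotated])
      then show thesis
        by (intro that[of "pi / 4" "pi / 2"]) (auto simp: cos_45)
    qed
    have "x1 \<in> J" using x by auto
    show ?thesis
      by (intro conjI impI deriv_coeff_F_zero_iff[OF \<open>x1 \<in> J\<close> x(4) sin_nz])
        (use no_invariant_density[OF _ x sin_nz] in blast)+
  qed
  have part3: "canonical_on ((C \<times> UNIV) \<times> UNIV) (sleigh_change m I) \<and>
      (\<forall>z \<in> (C \<times> UNIV) \<times> UNIV. sleigh_Hbar m I U z = point_H m (point_V m I U C) (sleigh_change m I z))"
    if C: "C \<in> {{0<..<pi}, {pi<..<2 * pi}}" for C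
  proof -
    obtain \<kappa> :: real where K: "(\<kappa>, C) \<in> {(1, {0<..<pi}), (- 1, {pi<..<2 * pi})}"
      using C by blast
    show ?thesis
      by (intro conjI ballI canonical_sleigh_change[OF m_pos I_pos K] Hbar_eq_point_H[OF m_pos I_pos K])
  qed
  have Ham: "\<forall>q P. sin (fst q) \<noteq> 0 \<longrightarrow> sleigh_H m I a U q P = sleigh_Hbar m I U (q, sleigh_N q *\<^sub>R P)"
    if a: "a = 0"
    by (intro allI impI Ham_a_zero[OF a])
  have sol: "\<forall>T \<gamma>. open T \<and> is_interval T \<and> (\<forall>t\<in>T. sin (fst (fst (\<gamma> t))) \<noteq> 0) \<longrightarrow>
              (solves_on (sleigh_field m I a U) T \<gamma> \<longleftrightarrow>
               solves_on (conf_ham_field sleigh_N (sleigh_Hbar m I U)) T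
                 (\<lambda>t. (fst (\<gamma> t), sleigh_N (fst (\<gamma> t)) *\<^sub>R snd (\<gamma> t))))"
    if a: "a = 0"
    by (intro allI impI solves_on_a_zero[OF a]) auto
  show ?thesis
    by (intro conjI impI; (intro ballI)?; (rule part1 part3 sleigh_N_invariant Ham sol; assumption))
qed

end
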